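(* Let $d\geq 3$, $k\in\{0,2\}$, $\zeta>0$, let $\gamma(z)=\phi_{d,k}\big(\sqrt{2-2z}/\zeta\big)$ for $z\in[-1,1]$, and let $x_1,\ldots,x_n\in\mathbb{S}^{d-1}$ be distinct. Then the $n\times n$ matrix $$H_{ij}=\frac{1}{|\mathbb{S}^{d-1}|}\int_{\mathbb{S}^{d-1}}\gamma(x_i^Tw)\,\gamma(w^Tx_j)\,dw,\qquad 1\le i,j\le n,$$ is strictly positive definite.
   Context: $\mathbb{S}^{d-1}$ is the unit sphere in $\mathbb{R}^d$, $dw$ is its surface measure and $|\mathbb{S}^{d-1}|$ its total surface measure. For $z\in\mathbb{R}$, $(z)_+=z$ if $z>0$ and $0$ otherwise. The Wendland functions considered are, for $r\ge 0$, $$\phi_{d,0}(r)=(1-r)_+^{\lfloor d/2\rfloor+1},$$ $$\phi_{d,2}(r)=(1-r)_+^{\ell+2}\big[(\ell^2+4\ell+3)r^2+(3\ell+6)r+3\big],\qquad \ell=\lfloor d/2\rfloor+3.$$ *)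

theory Defs
  imports "HOL-Analysis.Analysis"
begin

text \<open>
  Surface measure on the unit sphere, by the usual cone construction:
  the surface measure of \<open>A\<close> is the dimension times the Lebesgue measure of
  \<open>{r *\<^sub>R a | 0 < r \<le> 1, a \<in> A}\<close>.  It is not normalized, so its total mass is the surface area.
\<close>

definition sphere_measure :: "'a::euclidean_space measure" where
  "sphere_measure =
     scale_measure (of_nat DIM('a))
       (distr (restrict_space lborel (cball 0 1 - {0})) (restrict_space borel (sphere 0 1)) sgn)"

lemma space_sphere_measure: "space sphere_measure = sphere 0 1"
  by (simp add: sphere_measure_def space_scale_measure space_restrict_space)

lemma sets_sphere_measure: "sets sphere_measure = sets (restrict_space borel (sphere 0 1))"
  by (simp add: sphere_measure_def)

lemma emeasure_sphere_measure:
  fixes A :: "'a::euclidean_space set"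
  assumes "A \<in> sets borel" "A \<subseteq> sphere 0 1"
  shows "emeasure sphere_measure A =
           of_nat DIM('a) * emeasure lborel {r *\<^sub>R a |r a. 0 < r \<and> r \<le> 1 \<and> a \<in> A}"
proof -
  let ?B = "cball 0 1 - {0 :: 'a}"
  have meas: "sgn \<in> measurable (restrict_space lborel ?B) (restrict_space borel (sphere (0::'a) 1))"
  proof (rule measurable_restrict_space2)
    show "sgn \<in> space (restrict_space lborel ?B) \<rightarrow> sphere (0::'a) 1"
      by (auto simp: space_restrict_space norm_sgn)
    have "continuous_on ?B (sgn :: 'a \<Rightarrow> 'a)"
      unfolding sgn_div_norm by (intro continuous_intros) auto
    then have "sgn \<in> borel_measurable (restrict_space borel ?B)"
      by (rule borel_measurable_continuous_on_restrict)
    then show "sgn \<in> borel_measurable (restrict_space lborel ?B)"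
      by (simp cong: measurable_cong_sets add: sets_restrict_space)
  qed
  have A: "A \<in> sets (restrict_space borel (sphere 0 1))"
    using assms by (auto simp: sets_restrict_space_iff)
  have eq: "sgn -` A \<inter> ?B = {r *\<^sub>R a |r a. 0 < r \<and> r \<le> 1 \<and> a \<in> A}" (is "?L = ?R")
  proof (intro equalityI subsetI)
    fix y assume y: "y \<in> ?L"
    then have "y = norm y *\<^sub>R sgn y" "0 < norm y" "norm y \<le> 1" "sgn y \<in> A"
      by (auto simp: sgn_div_norm)
    then show "y \<in> ?R" by blast
  next
    fix y assume "y \<in> ?R"
    then obtain r a where ra: "y = r *\<^sub>R a" "0 < r" "r \<le> 1" "a \<in> A" by blast
    moreover have "norm a = 1" using ra assms by auto
    ultimately show "y \<in> ?L" by (auto simp: sgn_div_norm)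
  qed
  have "emeasure (restrict_space lborel ?B) ?L = emeasure lborel ?L"
    by (rule emeasure_restrict_space) auto
  then show ?thesis
    using emeasure_distr[OF meas A] eq
    by (simp add: sphere_measure_def space_restrict_space)
qed

definition pos_part :: "real \<Rightarrow> real" where
  "pos_part z = (if z > 0 then z else 0)"

text \<open>Wendland functions (meaningful for \<open>r \<ge> 0\<close>); only \<open>k \<in> {0, 2}\<close> is specified.\<close>

definition wendland :: "nat \<Rightarrow> nat \<Rightarrow> real \<Rightarrow> real" where
  "wendland d k r =
     (if k = 0 then pos_part (1 - r) ^ (d div 2 + 1)
      else if k = 2 then
        (let l = d div 2 + 3
         in pos_part (1 - r) ^ (l + 2) *
              ((real l ^ 2 + 4 * real l + 3) * r ^ 2 + (3 * real l + 6) * r + 3))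
      else undefined)"

definition strictly_positive_definite :: "real ^ 'n ^ 'n::finite \<Rightarrow> bool" where
  "strictly_positive_definite A \<longleftrightarrow>
     transpose A = A \<and> (\<forall>v. v \<noteq> 0 \<longrightarrow> v \<bullet> (A *v v) > 0)"

end

theory Submission
  imports Defs "HOL-Library.Landau_Symbols" "HOL-Computational_Algebra.Polynomial"
begin

text \<open>
  The quadratic form of \<open>H\<close> at \<open>v\<close> is the mean over the sphere of \<open>F\<^sup>2\<close>, where
  \<open>F w = (\<Sum>i. v $ i * \<gamma> (x i \<bullet> w))\<close>. Since \<open>F\<close> is continuous and the surface measure is positive
  on nonempty relatively open sets (\<open>emeasure_sphere_measure_pos\<close>), strict positivity says that the zonal
  functions \<open>w \<mapsto> \<gamma> (x i \<bullet> w)\<close> are linearly independent on the sphere.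

  Independence is read off from singularities. For unit vectors
  \<open>sqrt (2 - 2 * (a \<bullet> w))\<close> is the distance from \<open>a\<close> to \<open>w\<close>, so each zonal function is
  \<open>\<psi> (norm (a - w) / \<zeta>)\<close> with \<open>\<psi> r = pos_part (1 - r) ^ m * poly q r\<close>. There are two kinds of
  singularity. On the rim \<open>norm (a - w) = \<zeta>\<close> of its support the function vanishes to order \<open>m\<close>. At the
  centre \<open>w = a\<close> the even powers of the distance are smooth but the odd ones are not, and the
  polynomial \<open>(1 - r) ^ m * poly q r\<close> contains an odd power \<open>r ^ i\<close> with \<open>i < m\<close>: one may take
  \<open>i = 1\<close> when \<open>k = 0\<close> and \<open>i = 5\<close> when \<open>k = 2\<close> (\<open>wendland_truncated_power\<close>). So the singularity
  at the centre is strictly worse than any on a rim.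

  Suppose then that \<open>\<Sum>a\<in>A. v a * \<psi> (norm (a - w) / \<zeta>)\<close> vanishes on the sphere, and let \<open>w\<close> run
  through a point \<open>e\<close> of \<open>A\<close> along a great circle, parametrized by the signed chord length divided by
  \<open>\<zeta>\<close>. Every summand with \<open>a \<noteq> e\<close> agrees with a polynomial in the parameter \<open>s\<close> up to
  \<open>O(s ^ m)\<close>. The summand of \<open>e\<close> is \<open>v e\<close> times a polynomial in \<open>\<bar>s\<bar>\<close>, and its term
  \<open>\<bar>s\<bar> ^ i\<close> cannot be cancelled by a polynomial in \<open>s\<close> (\<open>odd_coeff_eq_0_if_has_jet_abs\<close>). Hence
  \<open>v e = 0\<close> (\<open>zonal_functions_independent\<close>).
\<close>

section \<open>Functions with a Peano expansion at the origin\<close>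

text \<open>
  A Taylor expansion in the sense of Peano, demanded only at the point 0 and with no derivatives
  involved. The degree of \<open>p\<close> is left free, since terms of degree at least \<open>m\<close> are absorbed by the
  error; this makes closure under products immediate.
\<close>

definition has_jet :: "nat \<Rightarrow> (real \<Rightarrow> real) \<Rightarrow> bool" where
  "has_jet m f \<longleftrightarrow> (\<exists>p. (\<lambda>s. f s - poly p s) \<in> O[at 0](\<lambda>s. s ^ m))"

lemma poly_tendsto: "(poly p \<longlongrightarrow> poly p a) (at (a::real) within A)"
  by (intro tendsto_intros tendsto_poly tendsto_ident_at)

lemma bounded_of_tendsto:
  fixes f :: "real \<Rightarrow> real"
  assumes "(f \<longlongrightarrow> c) F"
  shows "f \<in> O[F](\<lambda>_. 1)"
  using assms by (intro bigoI_tendsto[where c=c]) auto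

lemma has_jet_poly: "has_jet m (poly p)"
  unfolding has_jet_def by (intro exI[of _ p]) simp

lemma has_jet_const: "has_jet m (\<lambda>_. c)"
  unfolding has_jet_def by (intro exI[of _ "[:c:]"]) simp

lemma has_jet_cong:
  assumes "has_jet m f" "eventually (\<lambda>s. f s = g s) (at 0)"
  shows "has_jet m g"
proof -
  obtain p where p: "(\<lambda>s. f s - poly p s) \<in> O[at 0](\<lambda>s. s ^ m)"
    using assms(1) by (auto simp: has_jet_def)
  have "(\<lambda>s. g s - poly p s) \<in> O[at 0](\<lambda>s. s ^ m)"
    by (rule landau_o.big.in_cong[THEN iffD1, OF _ p]) (use assms(2) in \<open>auto elim: eventually_mono\<close>)
  then show ?thesis by (auto simp: has_jet_def)
qed

lemma has_jet_add:
  assumes "has_jet m f" "has_jet m g"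
  shows "has_jet m (\<lambda>s. f s + g s)"
proof -
  obtain p q where p: "(\<lambda>s. f s - poly p s) \<in> O[at 0](\<lambda>s. s ^ m)"
    and q: "(\<lambda>s. g s - poly q s) \<in> O[at 0](\<lambda>s. s ^ m)"
    using assms by (auto simp: has_jet_def)
  show ?thesis
    unfolding has_jet_def using sum_in_bigo(1)[OF p q]
    by (intro exI[of _ "p + q"]) (simp add: algebra_simps)
qed

lemma has_jet_bounded:
  assumes "has_jet m f"
  shows "f \<in> O[at 0](\<lambda>_. 1)"
proof -
  obtain p where p: "(\<lambda>s. f s - poly p s) \<in> O[at 0](\<lambda>s. s ^ m)"
    using assms by (auto simp: has_jet_def)
  have "(\<lambda>s::real. s ^ m) \<in> O[at 0](\<lambda>_. 1)"
    by (rule bounded_of_tendsto[where c = "0 ^ m"]) (intro tendsto_intros)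
  then have "(\<lambda>s. f s - poly p s) \<in> O[at 0](\<lambda>_. 1)"
    using landau_o.big_trans[OF p] by simp
  from sum_in_bigo(1)[OF this bounded_of_tendsto[OF poly_tendsto[of p]]]
  show ?thesis by simp
qed

lemma has_jet_mult:
  assumes "has_jet m f" "has_jet m g"
  shows "has_jet m (\<lambda>s. f s * g s)"
proof -
  obtain p q where p: "(\<lambda>s. f s - poly p s) \<in> O[at 0](\<lambda>s. s ^ m)"
    and q: "(\<lambda>s. g s - poly q s) \<in> O[at 0](\<lambda>s. s ^ m)"
    using assms by (auto simp: has_jet_def)
  have 1: "(\<lambda>s. f s * (g s - poly q s)) \<in> O[at 0](\<lambda>s. s ^ m)"
    using landau_o.big_mult[OF has_jet_bounded[OF assms(1)] q] by simp
  have 2: "(\<lambda>s. poly q s * (f s - poly p s)) \<in> O[at 0](\<lambda>s. s ^ m)"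
    using landau_o.big_mult[OF bounded_of_tendsto[OF poly_tendsto[of q]] p] by simp
  show ?thesis
    unfolding has_jet_def using sum_in_bigo(1)[OF 1 2]
    by (intro exI[of _ "p * q"]) (simp add: algebra_simps)
qed

lemma has_jet_sum:
  assumes "\<And>i. i \<in> A \<Longrightarrow> has_jet m (f i)"
  shows "has_jet m (\<lambda>s. \<Sum>i\<in>A. f i s)"
  using assms by (induction A rule: infinite_finite_induct) (simp_all add: has_jet_add has_jet_const)

lemma has_jet_poly_compose:
  assumes "has_jet m f"
  shows "has_jet m (\<lambda>s. poly p (f s))"
  by (induction p) (simp_all add: has_jet_add has_jet_const has_jet_mult assms)

lemma dvd_bigo:
  fixes p :: "real poly"
  assumes "[:0, 1:] ^ m dvd p"
  shows "poly p \<in> O[at 0](\<lambda>s. s ^ m)"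
proof -
  obtain q where q: "p = [:0, 1:] ^ m * q" using assms by blast
  have "(\<lambda>s. s ^ m * poly q s) \<in> O[at 0](\<lambda>s. s ^ m * 1)"
    by (intro landau_o.big_mult landau_o.big_refl bounded_of_tendsto[OF poly_tendsto])
  moreover have "poly p = (\<lambda>s. s ^ m * poly q s)" by (auto simp: q)
  ultimately show ?thesis by simp
qed

text \<open>
  The square root of a power series with positive constant term, computed coefficient by
  coefficient: if \<open>q\<^sup>2 - p = X * e\<close> with \<open>X = s ^ Suc m\<close>, then adding \<open>\<alpha> X\<close> to \<open>q\<close> changes the
  constant term of the cofactor \<open>e\<close> by \<open>2 * \<alpha> * poly q 0\<close>, and \<open>\<alpha>\<close> is chosen to cancel it.
\<close>

lemma poly_sqrt_mod_power:
  fixes p :: "real poly"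
  assumes "poly p 0 > 0"
  shows "\<exists>q. poly q 0 = sqrt (poly p 0) \<and> [:0, 1:] ^ Suc m dvd q\<^sup>2 - p"
proof (induction m)
  case 0
  show ?case
    using assms by (intro exI[of _ "[:sqrt (poly p 0):]"])
      (auto simp: dvd_iff_poly_eq_0[of 0, simplified])
next
  case (Suc m)
  then obtain q e where q: "poly q 0 = sqrt (poly p 0)" "q\<^sup>2 - p = [:0, 1:] ^ Suc m * e"
    by (auto elim!: dvdE)
  define \<alpha> where "\<alpha> = - poly e 0 / (2 * sqrt (poly p 0))"
  define X :: "real poly" where "X = [:0, 1:] ^ Suc m"
  have X0: "poly X 0 = 0" by (simp add: X_def)
  define q' where "q' = q + smult \<alpha> X"
  have "[:0, 1:] dvd e + smult (2 * \<alpha>) q + smult (\<alpha>\<^sup>2) X"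
    using assms by (simp add: dvd_iff_poly_eq_0[of 0, simplified] X0 q \<alpha>_def)
  moreover have "q'\<^sup>2 - p = X * (e + smult (2 * \<alpha>) q + smult (\<alpha>\<^sup>2) X)"
  proof -
    have "q'\<^sup>2 - p = (q\<^sup>2 - p) + (smult (2 * \<alpha>) (q * X) + smult (\<alpha>\<^sup>2) (X * X))"
      by (intro poly_eq_poly_eq_iff[THEN iffD1] ext)
        (simp add: q'_def power2_eq_square algebra_simps)
    then show ?thesis
      unfolding q(2) X_def[symmetric] by (simp add: algebra_simps)
  qed
  ultimately have "[:0, 1:] ^ Suc (Suc m) dvd q'\<^sup>2 - p"
    by (simp add: X_def mult.commute[of "[:0, 1:]"] mult_dvd_mono del: mult_pCons_left mult_pCons_right)
  moreover have "poly q' 0 = sqrt (poly p 0)" by (simp add: q'_def X0 q)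
  ultimately show ?case by blast
qed

lemma tendsto_0_if_bigo_power:
  fixes f :: "real \<Rightarrow> real"
  assumes "f \<in> O[at 0 within A](\<lambda>s. s ^ m)" "m > 0"
  shows "(f \<longlongrightarrow> 0) (at 0 within A)"
proof -
  have "(\<lambda>s::real. s ^ m) \<in> o[at 0 within A](\<lambda>_. 1)"
    by (rule smalloI_tendsto) (use \<open>m > 0\<close> in \<open>auto intro!: tendsto_eq_intros\<close>)
  with assms(1) have "f \<in> o[at 0 within A](\<lambda>_. 1)"
    by (rule landau_o.big_small_trans)
  from smalloD_tendsto[OF this] show ?thesis by simp
qed

lemma has_jet_value:
  fixes f :: "real \<Rightarrow> real"
  assumes "(\<lambda>s. f s - poly p s) \<in> O[at 0](\<lambda>s. s ^ m)" "m > 0" "(f \<longlongrightarrow> c) (at 0)"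
  shows "poly p 0 = c"
proof -
  have "((\<lambda>s. f s - poly p s) \<longlongrightarrow> 0) (at 0)"
    using assms(1,2) by (rule tendsto_0_if_bigo_power)
  moreover have "((\<lambda>s. f s - poly p s) \<longlongrightarrow> c - poly p 0) (at 0)"
    by (intro tendsto_diff assms poly_tendsto)
  ultimately show ?thesis using tendsto_unique[of "at (0::real)"] by fastforce
qed

text \<open>
  If \<open>q\<^sup>2\<close> agrees with \<open>f\<close> up to the error, then so does \<open>q\<close> with \<open>sqrt f\<close>, because
  \<open>sqrt f - q = (f - q\<^sup>2) / (sqrt f + q)\<close> and the denominator stays away from 0.
\<close>

lemma has_jet_sqrt:
  assumes f: "has_jet m f" and m: "m > 0" and lim: "(f \<longlongrightarrow> c) (at 0)" and c: "c > 0"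
  shows "has_jet m (\<lambda>s. sqrt (f s))"
proof -
  obtain p where p: "(\<lambda>s. f s - poly p s) \<in> O[at 0](\<lambda>s. s ^ m)"
    using f by (auto simp: has_jet_def)
  have p0: "poly p 0 = c" using has_jet_value[OF p m lim] .
  obtain q where q: "poly q 0 = sqrt c" "[:0, 1:] ^ Suc m dvd q\<^sup>2 - p"
    using poly_sqrt_mod_power[of p m] p0 c by auto
  have "[:0, 1:] ^ m dvd p - q\<^sup>2"
    using q(2) by (metis dvd_diff_commute dvd_power_le dvd_refl le_SucI order_refl power_le_dvd)
  then have "poly (p - q\<^sup>2) \<in> O[at 0](\<lambda>s. s ^ m)" by (rule dvd_bigo)
  from sum_in_bigo(1)[OF p this]
  have num: "(\<lambda>s. f s - (poly q s)\<^sup>2) \<in> O[at 0](\<lambda>s. s ^ m)" by simp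
  have "((\<lambda>s. inverse (sqrt (f s) + poly q s)) \<longlongrightarrow> inverse (sqrt c + sqrt c)) (at 0)"
    using poly_tendsto[of q 0 UNIV] c unfolding q(1) by (intro tendsto_intros lim) auto
  then have "(\<lambda>s. inverse (sqrt (f s) + poly q s)) \<in> O[at 0](\<lambda>_. 1)"
    by (rule bounded_of_tendsto)
  from landau_o.big_mult[OF num this]
  have quot: "(\<lambda>s. (f s - (poly q s)\<^sup>2) * inverse (sqrt (f s) + poly q s)) \<in> O[at 0](\<lambda>s. s ^ m)"
    by simp
  have "eventually (\<lambda>s. f s > 0) (at 0)" using lim c by (rule order_tendstoD)
  moreover have "eventually (\<lambda>s. poly q s > 0) (at 0)"
    using poly_tendsto[of q 0] by (rule order_tendstoD) (use q c in auto)
  ultimately have "eventually (\<lambda>s. (f s - (poly q s)\<^sup>2) * inverse (sqrt (f s) + poly q s)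
      = sqrt (f s) - poly q s) (at 0)"
  proof eventually_elim
    case (elim s)
    then have "f s = (sqrt (f s))\<^sup>2" "sqrt (f s) + poly q s \<noteq> 0"
      by (auto simp: add_pos_pos less_imp_neq[symmetric])
    then show ?case
      by (subst \<open>f s = _\<close>) (simp add: field_simps power2_eq_square)
  qed
  from landau_o.big.in_cong[THEN iffD1, OF this quot] show ?thesis
    by (auto simp: has_jet_def)
qed

text \<open>
  Away from \<open>c = 1\<close> the function is eventually a polynomial in \<open>f\<close>, or eventually zero. At the rim
  \<open>c = 1\<close> it need not be smooth, but \<open>1 - f s\<close> is then \<open>O(s)\<close>, so its \<open>m\<close>-th power is nothing but
  error and the zero polynomial is a valid expansion. This is why the order of the expansions is
  tied to the exponent of the truncated power.
\<close>

lemma has_jet_truncated_power: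
  assumes f: "has_jet m f" and m: "m > 0" and lim: "(f \<longlongrightarrow> c) (at 0)"
  shows "has_jet m (\<lambda>s. pos_part (1 - f s) ^ m * poly q (f s))"
proof -
  consider "c < 1" | "c > 1" | "c = 1" by linarith
  then show ?thesis
  proof cases
    case 1
    have "has_jet m (\<lambda>s. poly ([:1, -1:] ^ m * q) (f s))"
      by (rule has_jet_poly_compose[OF f])
    moreover have "eventually (\<lambda>s. f s < 1) (at 0)" using lim 1 by (rule order_tendstoD)
    ultimately show ?thesis
      by (elim has_jet_cong) (auto simp: pos_part_def elim!: eventually_mono)
  next
    case 2
    have "eventually (\<lambda>s. f s > 1) (at 0)" using lim 2 by (rule order_tendstoD)
    with m show ?thesis
      by (intro has_jet_cong[OF has_jet_const[of m 0]])
        (auto simp: pos_part_def elim!: eventually_mono)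
  next
    case 3
    obtain p where p: "(\<lambda>s. f s - poly p s) \<in> O[at 0](\<lambda>s. s ^ m)"
      using f by (auto simp: has_jet_def)
    have p0: "poly p 0 = 1" using has_jet_value[OF p m lim] 3 by simp
    have "[:0, 1:] ^ 1 dvd p - 1" by (simp add: dvd_iff_poly_eq_0[of 0, simplified] p0)
    then have "poly (p - 1) \<in> O[at 0](\<lambda>s. s ^ 1)" by (rule dvd_bigo)
    moreover have "(\<lambda>s::real. s ^ m) \<in> O[at 0](\<lambda>s. s ^ 1)"
      using dvd_bigo[of 1 "[:0, 1:] ^ m"] m by (simp add: poly_power[abs_def])
    then have "(\<lambda>s. f s - poly p s) \<in> O[at 0](\<lambda>s. s ^ 1)"
      using p landau_o.big_trans by blast
    ultimately have "(\<lambda>s. f s - 1) \<in> O[at 0](\<lambda>s. s)"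
      using sum_in_bigo(1)[of "\<lambda>s. f s - poly p s" "at 0" "\<lambda>s. s" "poly (p - 1)"] by simp
    moreover have "(\<lambda>s. pos_part (1 - f s)) \<in> O[at 0](\<lambda>s. f s - 1)"
      by (intro landau_o.bigI[of 1]) (auto simp: pos_part_def)
    ultimately have "(\<lambda>s. pos_part (1 - f s)) \<in> O[at 0](\<lambda>s. s)"
      using landau_o.big_trans by blast
    then have "(\<lambda>s. pos_part (1 - f s) ^ m) \<in> O[at 0](\<lambda>s. s ^ m)"
      by (rule landau_o.big_power)
    from landau_o.big_mult[OF this has_jet_bounded[OF has_jet_poly_compose[OF f, of q]]]
    show ?thesis unfolding has_jet_def by (intro exI[of _ 0]) simp
  qed
qed

section \<open>Odd powers of the modulus as an obstruction to Peano expansions\<close>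

lemma coeff_eq_0_if_bigo:
  fixes p :: "real poly"
  assumes "poly p \<in> O[at_right 0](\<lambda>s. s ^ m)" "i < m"
  shows "coeff p i = 0"
  using assms
proof (induction m arbitrary: p i)
  case 0
  from \<open>i < 0\<close> show ?case by simp
next
  case (Suc m)
  obtain a q where p: "p = pCons a q" by (cases p)
  have "(poly p \<longlongrightarrow> 0) (at_right 0)"
    using Suc.prems(1) by (rule tendsto_0_if_bigo_power) simp
  moreover have "(poly p \<longlongrightarrow> a) (at_right 0)" using poly_tendsto[of p 0] by (simp add: p)
  ultimately have a: "a = 0" using tendsto_unique[of "at_right (0::real)"] by fastforce
  have "(\<lambda>s. s * poly q s) \<in> O[at_right 0](\<lambda>s. s * s ^ m)"
    using Suc.prems(1) by (simp add: p a)
  then obtain C where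
    C: "eventually (\<lambda>s. norm (s * poly q s) \<le> C * norm (s * s ^ m)) (at_right 0)"
    by (elim landau_o.bigE)
  have "eventually (\<lambda>s::real. s > 0) (at_right 0)"
    by (rule eventually_at_right_less)
  with C have "eventually (\<lambda>s. norm (poly q s) \<le> C * norm (s ^ m)) (at_right 0)"
  proof eventually_elim
    case (elim s)
    then have "s * norm (poly q s) \<le> s * (C * norm (s ^ m))"
      by (simp add: abs_mult mult.left_commute)
    with \<open>s > 0\<close> show ?case by (simp only: mult_le_cancel_left_pos)
  qed
  then have "poly q \<in> O[at_right 0](\<lambda>s. s ^ m)"
    by (rule bigoI)
  note IH = Suc.IH[OF this]
  show ?case
  proof (cases i)
    case 0
    then show ?thesis by (simp add: p a)
  next
    case (Suc j)
    with IH[of j] \<open>i < Suc m\<close> show ?thesis by (simp add: p)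
  qed
qed

text \<open>
  A polynomial \<open>p\<close> approximating \<open>poly P \<bar>s\<bar>\<close> has the coefficients of \<open>P\<close> when seen from the right
  and those of \<open>P\<close> with alternating signs when seen from the left, below degree \<open>m\<close>. At an odd
  index this forces the coefficient of \<open>P\<close> to equal its own negative.
\<close>

lemma odd_coeff_eq_0_if_has_jet_abs:
  assumes jet: "has_jet m f" and f: "eventually (\<lambda>s. f s = poly P \<bar>s\<bar>) (at 0)"
    and i: "odd i" "i < m"
  shows "coeff P i = 0"
proof -
  obtain p where p: "(\<lambda>s. f s - poly p s) \<in> O[at 0](\<lambda>s. s ^ m)"
    using jet by (auto simp: has_jet_def)
  have P: "(\<lambda>s. poly P \<bar>s\<bar> - poly p s) \<in> O[at 0](\<lambda>s. s ^ m)"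
  proof (rule landau_o.big.in_cong[THEN iffD1, OF _ p])
    show "eventually (\<lambda>s. f s - poly p s = poly P \<bar>s\<bar> - poly p s) (at 0)"
      using f by eventually_elim simp
  qed
  have pos: "eventually (\<lambda>s::real. s > 0) (at_right 0)"
    by (rule eventually_at_right_less)
  have "(\<lambda>s. poly P \<bar>s\<bar> - poly p s) \<in> O[at_right 0](\<lambda>s. s ^ m)"
    by (rule landau_o.big.filter_mono[OF _ P]) (simp add: at_le)
  moreover have "eventually (\<lambda>s. poly P \<bar>s\<bar> - poly p s = poly (P - p) s) (at_right 0)"
    using pos by eventually_elim simp
  ultimately have "poly (P - p) \<in> O[at_right 0](\<lambda>s. s ^ m)"
    by (rule landau_o.big.in_cong[THEN iffD1, rotated])
  then have 1: "coeff (P - p) i = 0" using i(2) by (rule coeff_eq_0_if_bigo)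
  have "filterlim uminus (at (0::real)) (at_right 0)"
  proof (rule filterlim_atI)
    show "(uminus \<longlongrightarrow> (0::real)) (at_right 0)"
      using tendsto_minus[OF tendsto_ident_at[of "0::real" "{0<..}"]] by simp
    show "eventually (\<lambda>s::real. - s \<noteq> 0) (at_right 0)"
      using pos by eventually_elim simp
  qed
  from landau_o.big.compose[OF P this]
  have "(\<lambda>s. poly P \<bar>- s\<bar> - poly p (- s)) \<in> O[at_right 0](\<lambda>s. (- s) ^ m)" .
  moreover have "(\<lambda>s::real. (- s) ^ m) \<in> O[at_right 0](\<lambda>s. s ^ m)"
    by (rule landau_o.bigI[of 1]) (simp_all add: power_abs)
  ultimately have "(\<lambda>s. poly P \<bar>- s\<bar> - poly p (- s)) \<in> O[at_right 0](\<lambda>s. s ^ m)"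
    by (rule landau_o.big_trans)
  moreover have "eventually (\<lambda>s. poly P \<bar>- s\<bar> - poly p (- s) =
      poly (P - pcompose p [:0, -1:]) s) (at_right 0)"
    using pos by eventually_elim (simp add: poly_pcompose)
  ultimately have "poly (P - pcompose p [:0, -1:]) \<in> O[at_right 0](\<lambda>s. s ^ m)"
    by (rule landau_o.big.in_cong[THEN iffD1, rotated])
  then have 2: "coeff (P - pcompose p [:0, -1:]) i = 0" using i(2) by (rule coeff_eq_0_if_bigo)
  have "coeff (pcompose p [:0, -1:]) i = - coeff p i"
    using i by (simp add: coeff_pcompose_linear)
  with 1 2 show ?thesis by simp
qed

section \<open>Linear independence of zonal functions\<close>

text \<open>
  The dimension bound provides a direction \<open>u\<close> orthogonal to \<open>e\<close>, hence a great circle through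
  \<open>e\<close>. The curve \<open>C\<close> traverses it near \<open>e\<close> so that the chord from \<open>e\<close> to \<open>C s\<close> has length exactly
  \<open>\<zeta> * \<bar>s\<bar>\<close>: the summand belonging to \<open>e\<close> then is literally a polynomial in \<open>\<bar>s\<bar>\<close>, at the price
  of a square root in the coordinates of \<open>C\<close>.
\<close>

lemma zonal_functions_independent:
  fixes A :: "'a::euclidean_space set" and v :: "'a \<Rightarrow> real"
  assumes A: "finite A" "A \<subseteq> sphere 0 1" and dim: "DIM('a) \<ge> 2" and \<zeta>: "\<zeta> > 0"
    and i: "odd i" "i < m" "coeff ([:1, -1:] ^ m * q) i \<noteq> 0"
    and \<psi>: "\<And>r. \<psi> r = pos_part (1 - r) ^ m * poly q r"
    and zero: "\<And>w. w \<in> sphere 0 1 \<Longrightarrow> (\<Sum>a\<in>A. v a * \<psi> (sqrt (2 - 2 * (a \<bullet> w)) / \<zeta>)) = 0"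
    and e: "e \<in> A"
  shows "v e = 0"
proof -
  have norm_A: "norm a = 1" if "a \<in> A" for a using A that by auto
  obtain u0 where u0: "u0 \<noteq> 0" "orthogonal e u0"
    using orthogonal_to_vector_exists[OF dim] by blast
  define u where "u = sgn u0"
  have u: "u \<bullet> u = 1" "e \<bullet> u = 0" "u \<bullet> e = 0" and ee: "e \<bullet> e = 1"
    using u0 norm_A[OF e]
    by (auto simp: u_def sgn_div_norm orthogonal_def inner_commute dot_square_norm power2_eq_square)
  define R where "R = (\<lambda>s. sqrt (1 - (\<zeta> * s)\<^sup>2 / 4))"
  define C where "C = (\<lambda>s. (1 - (\<zeta> * s)\<^sup>2 / 2) *\<^sub>R e + (\<zeta> * s * R s) *\<^sub>R u)"
  have near: "eventually (\<lambda>s. \<bar>\<zeta> * s\<bar> < 2 \<and> \<bar>s\<bar> < 1) (at 0)"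
  proof (rule eventually_conj)
    have "((\<lambda>s. \<bar>\<zeta> * s\<bar>) \<longlongrightarrow> \<bar>\<zeta> * 0\<bar>) (at 0)" by (intro tendsto_intros)
    then show "eventually (\<lambda>s. \<bar>\<zeta> * s\<bar> < 2) (at 0)" by (rule order_tendstoD) simp
    have "((\<lambda>s. \<bar>s\<bar>) \<longlongrightarrow> \<bar>0::real\<bar>) (at 0)" by (intro tendsto_intros)
    then show "eventually (\<lambda>s::real. \<bar>s\<bar> < 1) (at 0)" by (rule order_tendstoD) simp
  qed
  have C_sphere: "C s \<in> sphere 0 1" if "\<bar>\<zeta> * s\<bar> < 2" for s
  proof -
    have "(\<zeta> * s)\<^sup>2 \<le> 2\<^sup>2" using that by (intro abs_le_square_iff[THEN iffD1]) auto
    then have R2: "(R s)\<^sup>2 = 1 - (\<zeta> * s)\<^sup>2 / 4" by (simp add: R_def)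
    have "C s \<bullet> C s = (1 - (\<zeta> * s)\<^sup>2 / 2)\<^sup>2 + (\<zeta> * s)\<^sup>2 * (R s)\<^sup>2"
      by (simp add: C_def inner_add_left inner_add_right u ee power2_eq_square)
    also have "\<dots> = 1" unfolding R2 by (simp add: power2_eq_square field_simps)
    finally have "C s \<bullet> C s = 1" .
    then show ?thesis by (simp add: norm_eq_sqrt_inner)
  qed
  have R_jet: "has_jet m R"
  proof -
    have "has_jet m (\<lambda>s. sqrt (poly [:1, 0, - \<zeta>\<^sup>2 / 4:] s))"
      using i by (intro has_jet_sqrt[OF has_jet_poly _ poly_tendsto]) auto
    then show ?thesis by (simp add: R_def power2_eq_square mult_ac)
  qed
  have inner_jet: "has_jet m (\<lambda>s. a \<bullet> C s)" for a
  proof -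
    have "has_jet m (\<lambda>s. poly [:a \<bullet> e, 0, - \<zeta>\<^sup>2 / 2 * (a \<bullet> e):] s + poly [:0, \<zeta> * (a \<bullet> u):] s * R s)"
      by (intro has_jet_add has_jet_mult R_jet has_jet_poly)
    then show ?thesis
      by (simp add: C_def inner_add_right power2_eq_square algebra_simps)
  qed
  have inner_lim: "((\<lambda>s. a \<bullet> C s) \<longlongrightarrow> a \<bullet> e) (at 0)" for a
    unfolding C_def R_def by (auto intro!: tendsto_eq_intros)
  define summand where "summand = (\<lambda>a s. v a * \<psi> (sqrt (2 - 2 * (a \<bullet> C s)) / \<zeta>))"
  \<comment> \<open>For \<open>a \<noteq> e\<close> the distance from \<open>a\<close> to \<open>C s\<close> stays positive near \<open>s = 0\<close>, so its square root
    expression is smooth there; only the rim of the support can interfere.\<close>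
  have others: "has_jet m (summand a)" if a: "a \<in> A - {e}" for a
  proof -
    have "a \<bullet> e < 1"
    proof -
      have "a \<bullet> e \<le> 1" using norm_cauchy_schwarz[of a e] norm_A e a by simp
      moreover have "a \<bullet> e \<noteq> 1"
        using norm_cauchy_schwarz_eq[of a e] norm_A e a by auto
      ultimately show ?thesis by simp
    qed
    then have pos: "2 - 2 * (a \<bullet> e) > 0" by simp
    have lim: "((\<lambda>s. 2 - 2 * (a \<bullet> C s)) \<longlongrightarrow> 2 - 2 * (a \<bullet> e)) (at 0)"
      by (intro tendsto_intros inner_lim)
    have "has_jet m (\<lambda>s. sqrt (2 - 2 * (a \<bullet> C s)))"
      using has_jet_poly_compose[OF inner_jet, where p = "[:2, -2:]"] i
      by (intro has_jet_sqrt[OF _ _ lim pos]) (auto simp: mult_ac)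
    from has_jet_mult[OF has_jet_const[of m "1 / \<zeta>"] this]
    have jet: "has_jet m (\<lambda>s. sqrt (2 - 2 * (a \<bullet> C s)) / \<zeta>)" by simp
    have "((\<lambda>s. sqrt (2 - 2 * (a \<bullet> C s)) / \<zeta>) \<longlongrightarrow> sqrt (2 - 2 * (a \<bullet> e)) / \<zeta>) (at 0)"
      using \<zeta> by (intro tendsto_intros lim) auto
    with i have "has_jet m (\<lambda>s. \<psi> (sqrt (2 - 2 * (a \<bullet> C s)) / \<zeta>))"
      unfolding \<psi> by (intro has_jet_truncated_power[OF jet]) auto
    then show ?thesis
      unfolding summand_def by (rule has_jet_mult[OF has_jet_const])
  qed
  have "has_jet m (\<lambda>s. (-1) * (\<Sum>a\<in>A - {e}. summand a s))"
    by (intro has_jet_mult has_jet_const has_jet_sum others)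
  moreover have "eventually (\<lambda>s. (-1) * (\<Sum>a\<in>A - {e}. summand a s) =
      poly (smult (v e) ([:1, -1:] ^ m * q)) \<bar>s\<bar>) (at 0)"
    using near
  proof eventually_elim
    case (elim s)
    \<comment> \<open>The summand of \<open>e\<close> is the negative of the sum of the others, so it inherits their expansion.\<close>
    have "2 - 2 * (e \<bullet> C s) = (\<zeta> * s)\<^sup>2"
      by (simp add: C_def inner_add_right u ee field_simps)
    then have "sqrt (2 - 2 * (e \<bullet> C s)) / \<zeta> = \<bar>s\<bar>" using \<zeta> by (simp add: abs_mult)
    then have "summand e s = poly (smult (v e) ([:1, -1:] ^ m * q)) \<bar>s\<bar>"
      using elim by (simp add: summand_def \<psi> pos_part_def)
    moreover have "summand e s + (\<Sum>a\<in>A - {e}. summand a s) = 0"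
      using zero[OF C_sphere, of s] elim A e by (simp add: summand_def sum.remove)
    ultimately show ?case by simp
  qed
  ultimately have "coeff (smult (v e) ([:1, -1:] ^ m * q)) i = 0"
    using i by (intro odd_coeff_eq_0_if_has_jet_abs)
  with i show ?thesis by simp
qed

section \<open>The Wendland functions as truncated powers\<close>

text \<open>
  With \<open>n = l + 2\<close> the quadratic factor of the Wendland function for \<open>k = 2\<close> is
  \<open>(n\<^sup>2 - 1) * r\<^sup>2 + 3 * n * r + 3\<close>. The product with \<open>(1 - r) ^ n\<close>, as a radial
  function, is four times continuously differentiable at the origin, so the coefficients of \<open>r\<close> and \<open>r ^ 3\<close> vanish; the fifth is the first
  odd one that can be used, and its closed form shows that it is negative.
\<close>

lemma wendland_2_coeff_5:
  fixes n :: nat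
  assumes "n \<ge> 5"
  shows "coeff ([:1, -1:] ^ n * [:3, 3 * real n, (real n)\<^sup>2 - 1:]) 5 =
    - (2 / 5) * real (n choose 3) * (real n + 1) * (real n + 2)"
proof -
  have c: "real (n choose k) = (\<Prod>i = 0..<k. real n - real i) / fact k" for k
    by (simp add: binomial_gbinomial gbinomial_prod_rev)
  have "coeff ([:1, -1:] ^ n * [:3, 3 * real n, (real n)\<^sup>2 - 1:]) 5 =
     3 * coeff ([:1, -1:] ^ n) 5 + 3 * real n * coeff ([:1, -1:] ^ n) 4
     + ((real n)\<^sup>2 - 1) * coeff ([:1, -1:] ^ n) 3"
    by (simp add: coeff_pCons numeral_eq_Suc)
  also have "\<dots> = - 3 * real (n choose 5) + 3 * real n * real (n choose 4)
      - ((real n)\<^sup>2 - 1) * real (n choose 3)"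
    using assms by (simp add: coeff_linear_poly_power)
  also have "\<dots> = - (2 / 5) * real (n choose 3) * (real n + 1) * (real n + 2)"
    unfolding c
    by (simp add: numeral_eq_Suc fact_numeral) (simp add: field_simps power2_eq_square)
  finally show ?thesis .
qed

text \<open>
  The exponent \<open>m\<close> is \<open>d div 2 + 1\<close> for \<open>k = 0\<close> and \<open>d div 2 + 5\<close> for \<open>k = 2\<close>, so \<open>d \<ge> 2\<close> is exactly
  what makes it exceed the odd index \<open>i\<close>, which is 1 and 5 respectively.
\<close>

lemma wendland_truncated_power:
  assumes "k \<in> {0, 2}" "d \<ge> 2"
  obtains m i q where "odd i" "i < m" "coeff ([:1, -1:] ^ m * q) i \<noteq> (0::real)"
    "\<And>r. wendland d k r = pos_part (1 - r) ^ m * poly q r"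
proof -
  consider "k = 0" | "k = 2" using assms by auto
  then show ?thesis
  proof cases
    case 1
    show ?thesis
    proof (rule that[of 1 "d div 2 + 1" 1])
      show "coeff ([:1, -1:] ^ (d div 2 + 1) * 1) 1 \<noteq> (0::real)"
        by (subst mult_1_right, subst coeff_linear_poly_power) auto
    qed (use assms 1 in \<open>auto simp: wendland_def\<close>)
  next
    case 2
    define l where "l = d div 2 + 3"
    define n where "n = l + 2"
    show ?thesis
    proof (rule that[of 5 n "[:3, 3 * real n, (real n)\<^sup>2 - 1:]"])
      have n: "n \<ge> 5" by (simp add: n_def l_def)
      then show "coeff ([:1, -1:] ^ n * [:3, 3 * real n, (real n)\<^sup>2 - 1:]) 5 \<noteq> 0"
        unfolding wendland_2_coeff_5[OF n] by (simp add: binomial_eq_0_iff)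
      show "wendland d k r = pos_part (1 - r) ^ n * poly [:3, 3 * real n, (real n)\<^sup>2 - 1:] r" for r
      proof -
        have eqs: "(real l)\<^sup>2 + 4 * real l + 3 = (real n)\<^sup>2 - 1" "3 * real l + 6 = 3 * real n"
          by (simp_all add: n_def power2_eq_square algebra_simps)
        have "wendland d k r = pos_part (1 - r) ^ n *
            (((real l)\<^sup>2 + 4 * real l + 3) * r\<^sup>2 + (3 * real l + 6) * r + 3)"
          using 2 unfolding n_def l_def by (simp add: wendland_def Let_def del: power_Suc)
        then show ?thesis unfolding eqs by (simp add: power2_eq_square algebra_simps)
      qed
    qed (use assms in \<open>auto simp: n_def l_def\<close>)
  qed
qed

section \<open>Surface measure on the sphere\<close>

lemma finite_sphere_measure: "finite_measure (sphere_measure :: 'a::euclidean_space measure)"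
proof
  have "emeasure lborel {r *\<^sub>R a |r a. 0 < r \<and> r \<le> 1 \<and> a \<in> sphere (0::'a) 1} \<le> emeasure lborel (cball (0::'a) 1)"
    by (rule emeasure_mono) auto
  also have "\<dots> < \<infinity>" by (rule emeasure_lborel_cball_finite)
  finally have "of_nat DIM('a) * emeasure lborel {r *\<^sub>R a |r a. 0 < r \<and> r \<le> 1 \<and> a \<in> sphere (0::'a) 1} < \<infinity>"
    by (simp add: ennreal_mult_less_top of_nat_less_top)
  then show "emeasure sphere_measure (space sphere_measure :: 'a set) \<noteq> \<infinity>"
    by (simp add: space_sphere_measure emeasure_sphere_measure)
qed

text \<open>
  The cone over a nonempty relatively open subset of the sphere contains a nonempty open set of the
  ambient space, namely its part strictly inside the unit ball.
\<close>

lemma emeasure_sphere_measure_pos: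
  fixes U :: "'a::euclidean_space set"
  assumes U: "openin (top_of_set (sphere 0 1)) U" "U \<noteq> {}"
  shows "emeasure sphere_measure U > 0"
proof -
  obtain T where T: "open T" "U = sphere 0 1 \<inter> T" using U(1) by (auto simp: openin_open)
  let ?cone = "{r *\<^sub>R a |r a. 0 < r \<and> r \<le> 1 \<and> a \<in> U}"
  have unit: "norm a = 1" if "a \<in> U" for a using that T by auto
  have cone: "?cone = (sgn -` T) \<inter> (cball 0 1 - {0})"
  proof (intro equalityI subsetI)
    fix y assume "y \<in> (sgn -` T) \<inter> (cball 0 1 - {0})"
    then have "y = norm y *\<^sub>R sgn y" "0 < norm y" "norm y \<le> 1" "sgn y \<in> U"
      by (auto simp: sgn_div_norm T)
    then show "y \<in> ?cone" by blast
  qed (use T in \<open>auto simp: sgn_div_norm\<close>)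
  have "sgn -` T \<inter> space borel \<in> sets borel"
    using T(1) by (intro measurable_sets[OF borel_measurable_sgn]) auto
  then have meas: "?cone \<in> sets lborel" unfolding cone by auto
  define V where "V = (ball 0 1 - {0}) \<inter> sgn -` T"
  have "continuous_on (ball 0 1 - {0}) (sgn :: 'a \<Rightarrow> 'a)"
    unfolding sgn_div_norm by (intro continuous_intros) auto
  then have "open V"
    unfolding V_def using T(1) by (intro continuous_open_preimage) auto
  obtain w where w: "w \<in> U" using U(2) by blast
  then have "(1/2) *\<^sub>R w \<in> V"
    using unit[OF w] T by (auto simp: V_def sgn_div_norm)
  then have "\<not> negligible V" using open_not_negligible[OF \<open>open V\<close>] by blast
  then have "emeasure lborel V \<noteq> 0"
    using \<open>open V\<close> by (simp add: negligible_iff_emeasure0 borel_open)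
  moreover have "emeasure lborel V \<le> emeasure lborel ?cone"
    by (rule emeasure_mono[OF _ meas]) (auto simp: cone V_def)
  ultimately have "emeasure lborel ?cone \<noteq> 0" by auto
  moreover have "U \<in> sets borel" using T by auto
  ultimately show ?thesis
    using emeasure_sphere_measure[of U] T by (auto simp: zero_less_iff_neq_zero)
qed

lemma integrable_sphere_measure:
  fixes h :: "'a::euclidean_space \<Rightarrow> real"
  assumes h: "continuous_on (sphere 0 1) h"
  shows "integrable sphere_measure h"
proof -
  have "bounded (h ` sphere 0 1)"
    by (intro compact_imp_bounded compact_continuous_image h compact_sphere)
  then obtain B where "\<And>w. w \<in> sphere 0 1 \<Longrightarrow> norm (h w) \<le> B"
    unfolding bounded_iff by blast
  then have "AE w in sphere_measure. norm (h w) \<le> B"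
    by (intro AE_I2) (simp add: space_sphere_measure)
  moreover have "h \<in> borel_measurable sphere_measure"
    using borel_measurable_continuous_on_restrict[OF h]
    by (simp cong: measurable_cong_sets add: sets_sphere_measure)
  ultimately show ?thesis
    by (rule finite_measure.integrable_const_bound[OF finite_sphere_measure])
qed

lemma sphere_integral_pos:
  fixes h :: "'a::euclidean_space \<Rightarrow> real"
  assumes h: "continuous_on (sphere 0 1) h" and nonneg: "\<And>w. w \<in> sphere 0 1 \<Longrightarrow> h w \<ge> 0"
    and w: "w \<in> sphere 0 1" "h w \<noteq> 0"
  shows "(LINT w|sphere_measure. h w) > 0"
proof -
  let ?U = "sphere 0 1 \<inter> h -` (- {0})"
  have nn: "AE w in sphere_measure. 0 \<le> h w"
    by (intro AE_I2) (simp add: space_sphere_measure nonneg)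
  have "openin (top_of_set (sphere 0 1)) ?U"
    using h by (rule continuous_openin_preimage_gen) auto
  then have pos: "emeasure sphere_measure ?U > 0"
    using w by (intro emeasure_sphere_measure_pos) auto
  then have meas: "?U \<in> sets sphere_measure"
    using emeasure_notin_sets by fastforce
  have "(LINT w|sphere_measure. h w) \<noteq> 0"
  proof
    assume "(LINT w|sphere_measure. h w) = 0"
    then have ae: "AE w in sphere_measure. h w = 0"
      using integral_nonneg_eq_0_iff_AE[OF integrable_sphere_measure[OF h] nn] by simp
    have "{w \<in> space sphere_measure. \<not> h w = 0} = ?U" by (auto simp: space_sphere_measure)
    with ae pos meas show False by (auto simp: AE_iff_measurable[of ?U])
  qed
  moreover have "(LINT w|sphere_measure. h w) \<ge> 0" using nn by (rule integral_nonneg_AE)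
  ultimately show ?thesis by simp
qed

section \<open>Strict positive definiteness\<close>

theorem theorem3p4:
  fixes k :: nat and \<zeta> :: real and \<gamma> :: "real \<Rightarrow> real"
    and x :: "'n::finite \<Rightarrow> real ^ 'd::finite"
    and H :: "real ^ 'n ^ 'n"
  assumes "CARD('d) \<ge> 3" and "k \<in> {0, 2}" and "\<zeta> > 0"
    and "\<And>z. z \<in> {-1..1} \<Longrightarrow> \<gamma> z = wendland CARD('d) k (sqrt (2 - 2 * z) / \<zeta>)"
    and "\<And>i. x i \<in> sphere 0 1" and "inj x"
    and "\<And>i j. H $ i $ j =
           1 / measure (sphere_measure :: (real ^ 'd) measure) (sphere 0 1) *
             (LINT w|sphere_measure. \<gamma> (x i \<bullet> w) * \<gamma> (w \<bullet> x j))"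
  shows "strictly_positive_definite H"
proof -
  let ?S = "sphere (0 :: real ^ 'd) 1"
  let ?M = "sphere_measure :: (real ^ 'd) measure"
  note \<gamma> = assms(4) and x = assms(5) and H = assms(7)
  obtain m i q where odd: "odd i" "i < m" "coeff ([:1, -1:] ^ m * q) i \<noteq> (0::real)"
    and \<psi>: "\<And>r. wendland CARD('d) k r = pos_part (1 - r) ^ m * poly q r"
  proof -
    have "2 \<le> CARD('d)" using assms(1) by simp
    from wendland_truncated_power[OF assms(2) this] that show ?thesis by metis
  qed
  have inner: "a \<bullet> w \<in> {-1..1}" if "a \<in> ?S" "w \<in> ?S" for a w
    using Cauchy_Schwarz_ineq2[of a w] that by (auto simp: abs_le_iff)
  have pos_part_max: "pos_part = (\<lambda>z. max z 0)" by (auto simp: pos_part_def)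
  have "continuous_on {-1..1} (\<lambda>z. wendland CARD('d) k (sqrt (2 - 2 * z) / \<zeta>))"
    unfolding \<psi> pos_part_max using assms(3) by (auto intro!: continuous_intros)
  then have cont: "continuous_on {-1..1} \<gamma>"
    by (rule continuous_on_cong[OF refl, THEN iffD2, rotated]) (rule \<gamma>)
  define g where "g = (\<lambda>i w. \<gamma> (x i \<bullet> w))"
  have g: "continuous_on ?S (g i)" for i
    unfolding g_def
    by (rule continuous_on_compose2[OF cont]) (auto intro!: continuous_intros dest: inner[OF x])
  have Hg: "H $ i $ j = (LINT w|?M. g i w * g j w) / measure ?M ?S" for i j
    by (simp add: H g_def inner_commute)
  have sym: "transpose H = H"
    by (simp add: vec_eq_iff transpose_def Hg mult.commute)
  have area: "measure ?M ?S > 0"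
  proof -
    interpret finite_measure ?M by (rule finite_sphere_measure)
    have "emeasure ?M ?S > 0"
      by (rule emeasure_sphere_measure_pos) auto
    then show ?thesis by (simp add: emeasure_eq_measure)
  qed
  have "v \<bullet> (H *v v) > 0" if "v \<noteq> 0" for v
  proof -
    define F where "F = (\<lambda>w. \<Sum>i\<in>UNIV. v $ i * g i w)"
    have F: "continuous_on ?S F" unfolding F_def by (intro continuous_intros g)
    have "v \<bullet> (H *v v) = (\<Sum>i\<in>UNIV. \<Sum>j\<in>UNIV. (v $ i * v $ j) * (LINT w|?M. g i w * g j w)) / measure ?M ?S"
      by (simp add: inner_vec_def matrix_vector_mult_def Hg sum_distrib_left sum_divide_distrib mult_ac)
    also have "(\<Sum>i\<in>UNIV. \<Sum>j\<in>UNIV. (v $ i * v $ j) * (LINT w|?M. g i w * g j w)) =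
        (LINT w|?M. (\<Sum>i\<in>UNIV. \<Sum>j\<in>UNIV. (v $ i * v $ j) * (g i w * g j w)))"
      by (subst Bochner_Integration.integral_sum;
          (subst Bochner_Integration.integral_sum)?;
          (intro integrable_sphere_measure continuous_intros g | simp)?)
    also have "\<dots> = (LINT w|?M. (F w)\<^sup>2)"
      by (simp add: F_def power2_eq_square sum_product mult_ac)
    finally have quad: "v \<bullet> (H *v v) = (LINT w|?M. (F w)\<^sup>2) / measure ?M ?S" .
    have "\<exists>w\<in>?S. F w \<noteq> 0"
    proof (rule ccontr)
      assume "\<not> ?thesis"
      then have F0: "F w = 0" if "w \<in> ?S" for w using that by auto
      obtain j where j: "v $ j \<noteq> 0" using \<open>v \<noteq> 0\<close> by (auto simp: vec_eq_iff)
      \<comment> \<open>Independence is stated for a set of points, so the coefficients are reindexed along the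
        injection \<open>x\<close>.\<close>
      have "v $ inv x (x j) = 0"
      proof (rule zonal_functions_independent[where A = "range x" and v = "\<lambda>a. v $ inv x a"])
        fix w assume w: "w \<in> ?S"
        have "(\<Sum>a\<in>range x. v $ inv x a * wendland CARD('d) k (sqrt (2 - 2 * (a \<bullet> w)) / \<zeta>)) = F w"
          using \<gamma>[OF inner[OF x w]] by (simp add: sum.reindex[OF assms(6)] F_def g_def assms(6))
        with F0[OF w]
        show "(\<Sum>a\<in>range x. v $ inv x a * wendland CARD('d) k (sqrt (2 - 2 * (a \<bullet> w)) / \<zeta>)) = 0"
          by simp
      qed (use odd \<psi> x assms(1,3) in auto)
      with j show False by (simp add: assms(6))
    qed
    then obtain w where "w \<in> ?S" "(F w)\<^sup>2 \<noteq> 0" by auto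
    then have "(LINT w|?M. (F w)\<^sup>2) > 0"
      by (intro sphere_integral_pos[of "\<lambda>w. (F w)\<^sup>2"]) (auto intro!: continuous_intros F)
    with area show ?thesis by (simp add: quad)
  qed
  with sym show ?thesis by (simp add: strictly_positive_definite_def)
qed

end
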